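(* Let $\mathcal{G}=\{G_w : w\in W\}$ be a set-based weighted graph on the complete undirected graph $G=\langle V,E\rangle$ with $m=|V|$ nodes, and assume $\mathcal{O}=\mathcal{O_T}$. Consider the following procedure: start with $F=\emptyset$; for each edge $e\in E$, form the graph $G'_e$ obtained from $G$ by removing $e$ and all edges dominated by $e$, and add $e$ to $F$ if and only if the endpoints of $e$ are not connected in $G'_e$; finally return $F$. Then the returned set $F$ is exactly the set of strong edges, and, if deciding whether one given edge dominates another takes constant time, the procedure can be carried out in time $O(m^4)$.
   Context: $G=\langle V,E\rangle$ is a fully connected (complete) undirected graph with finite node set $V$, $m=|V|$, and no loops. $W$ is a non-empty set of weight functions $w:E\to\mathbb{R}$; $G_w$ denotes $G$ with edge weights $w$, and $\mathcal{G}=\{G_w: w\in W\}$ is called a set-based weighted graph. For each $w$, a maximum spanning tree of $G_w$ is a spanning tree maximizing the sum of its edge weights under $w$ (there may be several). $\mathcal{T}$ is the set of all maximum spanning trees of all graphs $G_w$, $w\in W$. An edge is strong if it belongs to every tree in $\mathcal{T}$. Dominance: edge $e$ dominates edge $e'$ if $w(e)>w(e')$ for all $w\in W$. This is a strict partial order on $E$. $\mathcal{O}$ is the set of all strict total orders on $E$ extending the dominance partial order. $\mathcal{O_T}$ is the set of all strict total orders on $E$ that are consistent with some graph in $\mathcal{G}$, i.e. for which there is $w\in W$ such that $w(e)\ge w(e')$ whenever $e$ is above $e'$ in the order (equivalently, $w(e)>w(e')$ implies that $e$ is above $e'$). *)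

theory Defs
  imports Complex_Main "HOL-Library.Landau_Symbols"
begin

section \<open>Graphs and spanning trees\<close>

text \<open>
  An undirected edge is the two-element set of its endpoints. A weight function is a total
  function on sets, of which only the values on edges are ever used.
\<close>

definition complete_edges :: "'a set \<Rightarrow> 'a set set" where
  "complete_edges V = {{u, v} | u v. u \<in> V \<and> v \<in> V \<and> u \<noteq> v}"

definition connected_in :: "'a set set \<Rightarrow> 'a \<Rightarrow> 'a \<Rightarrow> bool" where
  "connected_in F u v \<longleftrightarrow> (u, v) \<in> {(x, y). {x, y} \<in> F}\<^sup>*"

definition is_cycle :: "'a set set \<Rightarrow> 'a list \<Rightarrow> bool" where
  "is_cycle F p \<longleftrightarrow> 3 \<le> length p \<and> distinct p \<and>
     (\<forall>i < length p. {p ! i, p ! (Suc i mod length p)} \<in> F)"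

definition spanning_tree :: "'a set \<Rightarrow> 'a set set \<Rightarrow> bool" where
  "spanning_tree V T \<longleftrightarrow> T \<subseteq> complete_edges V \<and>
     (\<forall>u \<in> V. \<forall>v \<in> V. connected_in T u v) \<and> \<not> (\<exists>p. is_cycle T p)"

definition max_spanning_tree :: "'a set \<Rightarrow> ('a set \<Rightarrow> real) \<Rightarrow> 'a set set \<Rightarrow> bool" where
  "max_spanning_tree V w T \<longleftrightarrow> is_arg_max (\<lambda>S. \<Sum>e\<in>S. w e) (spanning_tree V) T"

definition all_max_spanning_trees :: "'a set \<Rightarrow> ('a set \<Rightarrow> real) set \<Rightarrow> 'a set set set" where
  "all_max_spanning_trees V W = {T. \<exists>w \<in> W. max_spanning_tree V w T}"

definition strong_edges :: "'a set \<Rightarrow> ('a set \<Rightarrow> real) set \<Rightarrow> 'a set set" where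
  "strong_edges V W = {e \<in> complete_edges V. \<forall>T \<in> all_max_spanning_trees V W. e \<in> T}"


section \<open>Dominance and orders on the edges\<close>

definition dominates :: "'a set \<Rightarrow> ('a set \<Rightarrow> real) set \<Rightarrow> 'a set \<Rightarrow> 'a set \<Rightarrow> bool" where
  "dominates V W e e' \<longleftrightarrow>
     e \<in> complete_edges V \<and> e' \<in> complete_edges V \<and> (\<forall>w \<in> W. w e > w e')"

text \<open>In all orders below, \<open>(e, e') \<in> r\<close> means that \<open>e\<close> is above \<open>e'\<close>.\<close>

definition strict_total_orders :: "'a set \<Rightarrow> ('a set \<times> 'a set) set set" where
  "strict_total_orders V =
     {r. r \<subseteq> complete_edges V \<times> complete_edges V \<and> strict_linear_order_on (complete_edges V) r}"

definition dominance_extensions ::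
  "'a set \<Rightarrow> ('a set \<Rightarrow> real) set \<Rightarrow> ('a set \<times> 'a set) set set" where
  "dominance_extensions V W =
     {r \<in> strict_total_orders V. \<forall>e e'. dominates V W e e' \<longrightarrow> (e, e') \<in> r}"

definition consistent_orders ::
  "'a set \<Rightarrow> ('a set \<Rightarrow> real) set \<Rightarrow> ('a set \<times> 'a set) set set" where
  "consistent_orders V W =
     {r \<in> strict_total_orders V. \<exists>w \<in> W. \<forall>(e, e') \<in> r. w e \<ge> w e'}"


section \<open>The procedure\<close>

definition reduced_edges :: "'a set \<Rightarrow> ('a set \<Rightarrow> real) set \<Rightarrow> 'a set \<Rightarrow> 'a set set" where
  "reduced_edges V W e = complete_edges V - {e} - {e'. dominates V W e e'}"

definition endpoints_connected :: "'a set set \<Rightarrow> 'a set \<Rightarrow> bool" where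
  "endpoints_connected F e \<longleftrightarrow> (\<exists>u v. e = {u, v} \<and> connected_in F u v)"

text \<open>The list argument is the order in which the edges of the graph are visited.\<close>

definition procedure :: "'a set \<Rightarrow> ('a set \<Rightarrow> real) set \<Rightarrow> 'a set list \<Rightarrow> 'a set set" where
  "procedure V W es =
     fold (\<lambda>e F. if endpoints_connected (reduced_edges V W e) e then F else insert e F) es {}"


section \<open>Machine model for the running time\<close>

text \<open>
  A unit-cost imperative language with variables and arrays, both named by and holding natural
  numbers, and a dominance oracle. The only arithmetic operation is the successor, so that
  within \<open>t\<close> steps no value grows by more than \<open>t\<close> (apart from constants of the program) and
  unit cost is not abused.
\<close>

datatype com =
    Const nat nat              \<comment> \<open>\<open>x := n\<close>\<close>
  | Copy nat nat               \<comment> \<open>\<open>x := y\<close>\<close>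
  | Succ nat nat               \<comment> \<open>\<open>x := y + 1\<close>\<close>
  | Load nat nat nat           \<comment> \<open>\<open>x := a[y]\<close>\<close>
  | Store nat nat nat          \<comment> \<open>\<open>a[x] := y\<close>\<close>
  | Query nat nat nat nat nat  \<comment> \<open>\<open>x := 1\<close> if edge \<open>{y1, y2}\<close> dominates edge \<open>{z1, z2}\<close>, else \<open>x := 0\<close>\<close>
  | Seq com com
  | IfLess nat nat com com     \<comment> \<open>\<open>if x < y then c1 else c2\<close>\<close>
  | WhileLess nat nat com      \<comment> \<open>\<open>while x < y do c\<close>\<close>

type_synonym state = "(nat \<Rightarrow> nat) \<times> (nat \<Rightarrow> nat \<Rightarrow> nat)"

text \<open>
  \<open>exec orc q c s t s'\<close>: with oracle \<open>orc\<close> and cost \<open>q\<close> per oracle call, \<open>c\<close> started in \<open>s\<close>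
  terminates in \<open>s'\<close> after time \<open>t\<close>. Every other operation and every test costs 1.
\<close>

inductive exec ::
  "(nat \<Rightarrow> nat \<Rightarrow> nat \<Rightarrow> nat \<Rightarrow> bool) \<Rightarrow> nat \<Rightarrow> com \<Rightarrow> state \<Rightarrow> nat \<Rightarrow> state \<Rightarrow> bool"
  for orc q where
  "exec orc q (Const x n) (\<sigma>, \<alpha>) 1 (\<sigma>(x := n), \<alpha>)"
| "exec orc q (Copy x y) (\<sigma>, \<alpha>) 1 (\<sigma>(x := \<sigma> y), \<alpha>)"
| "exec orc q (Succ x y) (\<sigma>, \<alpha>) 1 (\<sigma>(x := Suc (\<sigma> y)), \<alpha>)"
| "exec orc q (Load x a y) (\<sigma>, \<alpha>) 1 (\<sigma>(x := \<alpha> a (\<sigma> y)), \<alpha>)"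
| "exec orc q (Store a x y) (\<sigma>, \<alpha>) 1 (\<sigma>, \<alpha>(a := (\<alpha> a)(\<sigma> x := \<sigma> y)))"
| "exec orc q (Query x y1 y2 z1 z2) (\<sigma>, \<alpha>) q
     (\<sigma>(x := (if orc (\<sigma> y1) (\<sigma> y2) (\<sigma> z1) (\<sigma> z2) then 1 else 0)), \<alpha>)"
| "exec orc q c1 s t1 s' \<Longrightarrow> exec orc q c2 s' t2 s'' \<Longrightarrow> exec orc q (Seq c1 c2) s (t1 + t2) s''"
| "\<sigma> x < \<sigma> y \<Longrightarrow> exec orc q c1 (\<sigma>, \<alpha>) t s' \<Longrightarrow>
     exec orc q (IfLess x y c1 c2) (\<sigma>, \<alpha>) (1 + t) s'"
| "\<not> \<sigma> x < \<sigma> y \<Longrightarrow> exec orc q c2 (\<sigma>, \<alpha>) t s' \<Longrightarrow>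
     exec orc q (IfLess x y c1 c2) (\<sigma>, \<alpha>) (1 + t) s'"
| "\<not> \<sigma> x < \<sigma> y \<Longrightarrow> exec orc q (WhileLess x y c) (\<sigma>, \<alpha>) 1 (\<sigma>, \<alpha>)"
| "\<sigma> x < \<sigma> y \<Longrightarrow> exec orc q c (\<sigma>, \<alpha>) t1 s' \<Longrightarrow> exec orc q (WhileLess x y c) s' t2 s'' \<Longrightarrow>
     exec orc q (WhileLess x y c) (\<sigma>, \<alpha>) (1 + t1 + t2) s''"

text \<open>
  The nodes are numbered by a list \<open>vs\<close>. The machine starts with the number of nodes in
  variable 0 and zeros everywhere else; apart from this it accesses the weighted graph only
  through the oracle. It leaves the number \<open>k\<close> of listed edges in variable 1 and the endpoints
  of the \<open>i\<close>-th listed edge, for \<open>i < k\<close>, in cell \<open>i\<close> of arrays 0 and 1.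
\<close>

definition dominance_oracle ::
  "'a list \<Rightarrow> ('a set \<Rightarrow> real) set \<Rightarrow> nat \<Rightarrow> nat \<Rightarrow> nat \<Rightarrow> nat \<Rightarrow> bool" where
  "dominance_oracle vs W i j k l \<longleftrightarrow>
     i < length vs \<and> j < length vs \<and> k < length vs \<and> l < length vs \<and>
     dominates (set vs) W {vs ! i, vs ! j} {vs ! k, vs ! l}"

definition initial_state :: "nat \<Rightarrow> state" where
  "initial_state m = ((\<lambda>_. 0)(0 := m), \<lambda>_ _. 0)"

definition output_edges :: "'a list \<Rightarrow> state \<Rightarrow> 'a set set" where
  "output_edges vs s = {{vs ! (snd s 0 i), vs ! (snd s 1 i)} | i. i < fst s 1}"

definition computes_within ::
  "com \<Rightarrow> nat \<Rightarrow> 'a list \<Rightarrow> ('a set \<Rightarrow> real) set \<Rightarrow> nat \<Rightarrow> 'a set set \<Rightarrow> bool" where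
  "computes_within c q vs W b F \<longleftrightarrow>
     (\<exists>t s. exec (dominance_oracle vs W) q c (initial_state (length vs)) t s \<and> t \<le> b \<and>
        (\<forall>i < fst s 1. snd s 0 i < length vs \<and> snd s 1 i < length vs) \<and>
        output_edges vs s = F)"

end

theory Submission
  imports Defs
begin

text \<open>
  An edge \<open>e\<close> missing from a maximum spanning tree can be exchanged for any edge on the tree
  path between its endpoints; if the reduced graph of \<open>e\<close> does not connect these endpoints,
  some edge on this path is dominated by \<open>e\<close>, which contradicts maximality. Conversely, some
  linear extension of dominance puts \<open>e\<close> below all edges of its reduced graph. A weight
  function consistent with it makes all these edges weigh at least as much as \<open>e\<close>, so if they
  connect the endpoints of \<open>e\<close>, then one of them can replace \<open>e\<close> in a maximum spanning tree.

  For the running time, a breadth-first search with an oracle call per ordered pair of nodes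
  decides each of the \<open>O(m\<^sup>2)\<close> edges in time \<open>O(m\<^sup>2)\<close>.
\<close>

section \<open>Connectivity and spanning trees\<close>

lemma connected_in_refl [simp]: "connected_in F u u"
  by (simp add: connected_in_def)

lemma connected_in_trans: "connected_in F u v \<Longrightarrow> connected_in F v x \<Longrightarrow> connected_in F u x"
  by (auto simp: connected_in_def)

lemma connected_in_edge: "{u, v} \<in> F \<Longrightarrow> connected_in F u v"
  by (auto simp: connected_in_def)

lemma connected_in_sym: "connected_in F u v \<Longrightarrow> connected_in F v u"
proof -
  have "sym ({(x, y). {x, y} \<in> F}\<^sup>*)"
    by (rule sym_rtrancl) (auto simp: sym_def insert_commute)
  then show "connected_in F u v \<Longrightarrow> connected_in F v u"
    unfolding connected_in_def by (rule symD)
qed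

text \<open>Each edge of the walk is replaced by an \<open>H\<close>-walk. Read contrapositively, if
  \<open>H\<close> separates \<open>u\<close> and \<open>v\<close>, then it separates the endpoints
  of some edge of \<open>F\<close>; this yields the exchange edge in
  \<open>strong_imp_disconnected\<close>.\<close>

lemma connected_in_hull:
  assumes "connected_in F u v" and "\<And>x y. {x, y} \<in> F \<Longrightarrow> connected_in H x y"
  shows "connected_in H u v"
  using assms(1) unfolding connected_in_def
proof (induction rule: rtrancl_induct)
  case (step y z)
  then have "connected_in H y z" using assms(2) by blast
  with step show ?case unfolding connected_in_def by auto
qed simp

lemma connected_in_mono: "connected_in F u v \<Longrightarrow> F \<subseteq> H \<Longrightarrow> connected_in H u v"
  by (erule connected_in_hull) (auto intro: connected_in_edge)

text \<open>Induction along the walk: whenever the new edge would be traversed a second time, the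
  walk can be shortened, so at most one traversal in one of the two directions remains.\<close>

lemma connected_in_insertE:
  assumes "connected_in (insert {a, b} F) u v"
  obtains "connected_in F u v"
    | "connected_in F u a" "connected_in F b v"
    | "connected_in F u b" "connected_in F a v"
proof -
  have "connected_in F u v \<or> connected_in F u a \<and> connected_in F b v
      \<or> connected_in F u b \<and> connected_in F a v"
    using assms unfolding connected_in_def
  proof (induction rule: rtrancl_induct)
    case (step y z)
    then have "{y, z} \<in> F \<or> y = a \<and> z = b \<or> y = b \<and> z = a"
      by (auto simp: doubleton_eq_iff)
    with step.IH show ?case
      using connected_in_edge[of y z F] connected_in_trans[of F _ y z] connected_in_refl[of F]
      unfolding connected_in_def[symmetric] by metis
  qed simp
  then show thesis using that by blast
qed

lemma connected_in_mono_sym: "connected_in F v u \<Longrightarrow> F \<subseteq> H \<Longrightarrow> connected_in H u v"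
  by (rule connected_in_sym) (rule connected_in_mono)

lemma simple_path_exists:
  assumes "connected_in F u v"
  obtains p where "p \<noteq> []" "hd p = u" "last p = v" "distinct p"
    "successively (\<lambda>x y. {x, y} \<in> F) p"
proof -
  have "\<exists>p. p \<noteq> [] \<and> hd p = u \<and> last p = v \<and> distinct p \<and> successively (\<lambda>x y. {x, y} \<in> F) p"
    using assms unfolding connected_in_def
  proof (induction rule: converse_rtrancl_induct)
    case base
    show ?case by (intro exI[of _ "[v]"]) simp
  next
    case (step x y)
    then obtain p where p: "p \<noteq> []" "hd p = y" "last p = v" "distinct p"
      "successively (\<lambda>x y. {x, y} \<in> F) p" by blast
    show ?case
    proof (cases "x \<in> set p")
      case True
      \<comment> \<open>The new start already lies on the path, so everything before its occurrence
        is cut off.\<close>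
      then obtain p1 p2 where "p = p1 @ x # p2" by (meson split_list)
      with p show ?thesis by (intro exI[of _ "x # p2"]) (auto simp: successively_append_iff)
    next
      case False
      with p step.hyps show ?thesis
        by (intro exI[of _ "x # p"]) (auto simp: successively_Cons)
    qed
  qed
  then show thesis using that by blast
qed

lemma complete_edges_iff: "{u, v} \<in> complete_edges V \<longleftrightarrow> u \<in> V \<and> v \<in> V \<and> u \<noteq> v"
  by (auto simp: complete_edges_def doubleton_eq_iff)

lemma finite_complete_edges: "finite V \<Longrightarrow> finite (complete_edges V)"
  by (rule finite_subset[of _ "Pow V"]) (auto simp: complete_edges_def)

text \<open>A graph has no cycle iff each of its edges is a bridge.\<close>

lemma acyclic_iff_bridges:
  assumes "F \<subseteq> complete_edges V"
  shows "\<not> (\<exists>p. is_cycle F p) \<longleftrightarrow> (\<forall>x y. {x, y} \<in> F \<longrightarrow> \<not> connected_in (F - {{x, y}}) x y)"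
proof
  assume acyc: "\<not> (\<exists>p. is_cycle F p)"
  show "\<forall>x y. {x, y} \<in> F \<longrightarrow> \<not> connected_in (F - {{x, y}}) x y"
  proof (intro allI impI notI)
    fix x y assume xy: "{x, y} \<in> F" and conn: "connected_in (F - {{x, y}}) x y"
    from conn obtain p where p: "p \<noteq> []" "hd p = x" "last p = y" "distinct p"
      "successively (\<lambda>a b. {a, b} \<in> F - {{x, y}}) p" by (rule simple_path_exists)
    have "x \<noteq> y" using subsetD[OF assms xy] complete_edges_iff[of x y] by simp
    \<comment> \<open>A path of one node would give \<open>x = y\<close>, and a path of two nodes
      would be the deleted edge itself.\<close>
    have "3 \<le> length p"
    proof (rule ccontr)
      assume "\<not> 3 \<le> length p"
      then have "length p = Suc 0 \<or> length p = Suc (Suc 0)"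
        using p(1) length_0_conv[of p] by linarith
      then have "(\<exists>a. p = [a]) \<or> (\<exists>a b. p = [a, b])" by (auto simp: length_Suc_conv)
      with p \<open>x \<noteq> y\<close> show False by auto
    qed
    have "{p ! i, p ! (Suc i mod length p)} \<in> F" if "i < length p" for i
    proof (cases "Suc i < length p")
      case True
      with p(5) show ?thesis by (auto simp: successively_conv_nth)
    next
      case False
      with that have "Suc i = length p" by simp
      \<comment> \<open>At the last index the successor wraps around to 0, and the deleted edge
        closes the path to a cycle.\<close>
      then have "p ! i = y" "p ! (Suc i mod length p) = x"
        using p(1-3) by (auto simp: last_conv_nth hd_conv_nth simp flip: \<open>Suc i = length p\<close>)
      with xy show ?thesis by (simp add: insert_commute)
    qed
    with \<open>3 \<le> length p\<close> p(4) have "is_cycle F p" by (simp add: is_cycle_def)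
    with acyc show False by blast
  qed
next
  assume bridges: "\<forall>x y. {x, y} \<in> F \<longrightarrow> \<not> connected_in (F - {{x, y}}) x y"
  show "\<not> (\<exists>p. is_cycle F p)"
  proof
    assume "\<exists>p. is_cycle F p"
    then obtain p where p: "3 \<le> length p" "distinct p"
      "\<And>i. i < length p \<Longrightarrow> {p ! i, p ! (Suc i mod length p)} \<in> F"
      unfolding is_cycle_def by blast
    \<comment> \<open>\<open>n\<close> is the last index, so \<open>?e\<close> closes the cycle, and
      the other edges lead from \<open>p ! 0\<close> to \<open>p ! n\<close> without it.\<close>
    define n where "n = length p - 1"
    have n: "length p = Suc n" "2 \<le> n" using p(1) by (auto simp: n_def)
    let ?e = "{p ! 0, p ! n}"
    have "connected_in (F - {?e}) (p ! 0) (p ! i)" if "i \<le> n" for i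
      using that
    proof (induction i)
      case (Suc i)
      have "{p ! i, p ! Suc i} \<in> F" using p(3)[of i] Suc.prems n by simp
      \<comment> \<open>By distinctness the two pairs could agree only for \<open>i = 0\<close> and
        \<open>n = 1\<close>, which a cycle of at least three nodes excludes.\<close>
      moreover have "{p ! i, p ! Suc i} \<noteq> ?e"
        using Suc.prems n p(2) by (auto simp: doubleton_eq_iff nth_eq_iff_index_eq)
      ultimately have "connected_in (F - {?e}) (p ! i) (p ! Suc i)"
        by (intro connected_in_edge) simp
      with Suc show ?case by (auto intro: connected_in_trans)
    qed simp
    from this[of n] have "connected_in (F - {?e}) (p ! 0) (p ! n)" by simp
    moreover have "?e \<in> F" using p(3)[of n] n by (simp add: insert_commute)
    ultimately show False using bridges by blast
  qed
qed

section \<open>Spanning trees: exchange, existence and maximality\<close>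

lemma spanning_tree_iff:
  "spanning_tree V T \<longleftrightarrow> T \<subseteq> complete_edges V \<and> (\<forall>u\<in>V. \<forall>v\<in>V. connected_in T u v) \<and>
     (\<forall>x y. {x, y} \<in> T \<longrightarrow> \<not> connected_in (T - {{x, y}}) x y)"
  unfolding spanning_tree_def using acyclic_iff_bridges by blast

text \<open>Deleting \<open>{a, b}\<close> splits the tree into two components, and
  \<open>{u, v}\<close> joins them again. Since acyclicity is phrased through bridges, both halves
  of the claim reduce to rerouting walks with \<open>connected_in_insertE\<close>.\<close>

lemma spanning_tree_exchange:
  assumes T: "spanning_tree V T" and ab: "{a, b} \<in> T" and uv: "{u, v} \<in> complete_edges V"
    and disc: "\<not> connected_in (T - {{a, b}}) u v"
  shows "spanning_tree V (insert {u, v} (T - {{a, b}}))"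
proof -
  let ?S = "T - {{a, b}}" and ?N = "insert {u, v} (T - {{a, b}})"
  have T_eq: "insert {a, b} ?S = T" using ab by blast
  have conn: "\<And>x y. x \<in> V \<Longrightarrow> y \<in> V \<Longrightarrow> connected_in T x y"
    and bridge: "\<And>x y. {x, y} \<in> T \<Longrightarrow> \<not> connected_in (T - {{x, y}}) x y"
    and sub: "T \<subseteq> complete_edges V"
    using T unfolding spanning_tree_iff by blast+
  have "connected_in (insert {a, b} ?S) u v"
    unfolding T_eq using uv conn complete_edges_iff by metis
  \<comment> \<open>The walk from \<open>u\<close> to \<open>v\<close> in \<open>T\<close> must
    cross \<open>{a, b}\<close>; its two pieces and the new edge form a detour from \<open>a\<close>
    to \<open>b\<close>.\<close>
  then have ab_N: "connected_in ?N a b"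
  proof (cases rule: connected_in_insertE)
    case 2
    have "connected_in ?N a u" using 2(1) by (rule connected_in_mono_sym) blast
    moreover have "connected_in ?N u v" by (rule connected_in_edge) blast
    moreover have "connected_in ?N v b" using 2(2) by (rule connected_in_mono_sym) blast
    ultimately show ?thesis by (meson connected_in_trans)
  next
    case 3
    have "connected_in ?N b u" using 3(1) by (rule connected_in_mono_sym) blast
    moreover have "connected_in ?N u v" by (rule connected_in_edge) blast
    moreover have "connected_in ?N v a" using 3(2) by (rule connected_in_mono_sym) blast
    ultimately show ?thesis by (meson connected_in_trans connected_in_sym)
  qed (use disc in blast)
  have "connected_in ?N x y" if "x \<in> V" "y \<in> V" for x y
    using conn[OF that]
  proof (rule connected_in_hull)
    fix x y assume "{x, y} \<in> T"
    then consider "{x, y} \<in> ?S" | "x = a" "y = b" | "x = b" "y = a"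
      by (auto simp: doubleton_eq_iff)
    then show "connected_in ?N x y"
      using ab_N by cases (auto intro: connected_in_edge connected_in_sym)
  qed
  moreover have "\<not> connected_in (?N - {{x, y}}) x y" if "{x, y} \<in> ?N" for x y
  proof (cases "{x, y} = {u, v}")
    case True
    have "{u, v} \<notin> ?S" using disc connected_in_edge[of u v ?S] by argo
    then have "?N - {{u, v}} = ?S" by (rule Diff_insert_absorb)
    then have "?N - {{x, y}} = ?S" using True by (simp only:)
    moreover have "x = u \<and> y = v \<or> x = v \<and> y = u" using True by (simp add: doubleton_eq_iff)
    ultimately show ?thesis using disc connected_in_sym by metis
  next
    case False
    then have xy: "{x, y} \<in> ?S" using that by blast
    let ?R = "?S - {{x, y}}"
    show ?thesis
    proof
      assume "connected_in (?N - {{x, y}}) x y"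
      moreover have "?N - {{x, y}} = insert {u, v} ?R" using False by auto
      ultimately have "connected_in (insert {u, v} ?R) x y" by (simp only:)
      \<comment> \<open>If the walk from \<open>x\<close> to \<open>y\<close> crosses
        \<open>{u, v}\<close>, then its pieces together with the edge \<open>{x, y}\<close> connect
        \<open>u\<close> and \<open>v\<close> in \<open>?S\<close>.\<close>
      then show False
      proof (cases rule: connected_in_insertE)
        case 1
        then have "connected_in (T - {{x, y}}) x y" by (rule connected_in_mono) blast
        with bridge xy show False by blast
      next
        case 2
        have "connected_in ?S u x" using 2(1) by (rule connected_in_mono_sym) blast
        moreover have "connected_in ?S x y" using xy by (rule connected_in_edge)
        moreover have "connected_in ?S y v" using 2(2) by (rule connected_in_mono_sym) blast
        ultimately show False using disc by (meson connected_in_trans)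
      next
        case 3
        have "connected_in ?S v x" using 3(1) by (rule connected_in_mono_sym) blast
        moreover have "connected_in ?S x y" using xy by (rule connected_in_edge)
        moreover have "connected_in ?S y u" using 3(2) by (rule connected_in_mono_sym) blast
        ultimately show False using disc by (meson connected_in_trans connected_in_sym)
      qed
    qed
  qed
  ultimately show ?thesis
    using sub uv unfolding spanning_tree_iff by blast
qed

lemma sum_exchange:
  fixes w :: "'b \<Rightarrow> real"
  assumes "finite T" "f \<in> T" "e \<notin> T"
  shows "sum w (insert e (T - {f})) = sum w T + w e - w f"
  using assms by (simp add: sum_diff1)

text \<open>A connecting edge set of least cardinality works: an edge that is not a bridge could be
  dropped from it.\<close>

lemma spanning_tree_exists:
  assumes "finite V"
  shows "\<exists>T. spanning_tree V T"
proof -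
  define P where "P S \<longleftrightarrow> S \<subseteq> complete_edges V \<and> (\<forall>u\<in>V. \<forall>v\<in>V. connected_in S u v)" for S
  have "P (complete_edges V)"
    unfolding P_def by (metis complete_edges_iff connected_in_edge connected_in_refl order_refl)
  then obtain S where S: "P S" and min: "\<And>S'. P S' \<Longrightarrow> card S \<le> card S'"
    using ex_has_least_nat[of P _ card] by blast
  have "finite S" using S assms finite_complete_edges finite_subset P_def by blast
  have "\<not> connected_in (S - {{x, y}}) x y" if "{x, y} \<in> S" for x y
  proof
    assume xy: "connected_in (S - {{x, y}}) x y"
    have "connected_in (S - {{x, y}}) u v" if "connected_in S u v" for u v
      using that
    proof (rule connected_in_hull)
      fix c d assume "{c, d} \<in> S"
      then consider "{c, d} \<in> S - {{x, y}}" | "c = x" "d = y" | "c = y" "d = x"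
        by (auto simp: doubleton_eq_iff)
      then show "connected_in (S - {{x, y}}) c d"
        using xy by cases (auto intro: connected_in_edge connected_in_sym)
    qed
    then have "P (S - {{x, y}})" using S unfolding P_def by blast
    from min[OF this] that \<open>finite S\<close> show False
      by (metis card_Diff1_less leD)
  qed
  then have "spanning_tree V S" using S unfolding spanning_tree_iff P_def by blast
  then show ?thesis ..
qed

lemma max_spanning_tree_exists:
  assumes "finite V"
  shows "\<exists>T. max_spanning_tree V w T"
proof -
  let ?A = "{T. spanning_tree V T}"
  have "?A \<subseteq> Pow (complete_edges V)" by (auto simp: spanning_tree_def)
  then have fin: "finite ?A" using assms finite_complete_edges finite_subset by blast
  have ne: "?A \<noteq> {}" using spanning_tree_exists[OF assms] by blast
  let ?f = "\<lambda>S. \<Sum>e\<in>S. w e"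
  obtain T where "T \<in> ?A" "?f T = Max (?f ` ?A)"
    using Max_in[of "?f ` ?A"] fin ne by (metis (no_types, lifting) finite_imageI imageE image_is_empty)
  moreover have "?f S \<le> Max (?f ` ?A)" if "S \<in> ?A" for S using fin that by simp
  ultimately show ?thesis
    unfolding max_spanning_tree_def is_arg_max_def by (metis mem_Collect_eq leD)
qed

lemma max_spanning_treeD:
  assumes "max_spanning_tree V w T"
  shows "spanning_tree V T" and "spanning_tree V S \<Longrightarrow> sum w S \<le> sum w T"
  using assms by (force simp: max_spanning_tree_def is_arg_max_def not_less)+

text \<open>A smallest subset of the tree connecting \<open>u\<close> and \<open>v\<close> plays the
  role of the tree path. It cannot lie inside \<open>H\<close>, and each of its edges separates
  \<open>u\<close> from \<open>v\<close> when deleted from \<open>T\<close>.\<close>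

lemma bridge_outside_exists:
  assumes "finite T" and bridge: "\<And>x y. {x, y} \<in> T \<Longrightarrow> \<not> connected_in (T - {{x, y}}) x y"
    and edges: "T \<subseteq> complete_edges V"
    and "connected_in T u v" "\<not> connected_in H u v"
  obtains a b where "{a, b} \<in> T" "{a, b} \<notin> H" "\<not> connected_in (T - {{a, b}}) u v"
proof -
  define P where "P S \<longleftrightarrow> S \<subseteq> T \<and> connected_in S u v" for S
  have "P T" using assms by (simp add: P_def)
  then obtain S where S: "P S" and min: "\<And>S'. P S' \<Longrightarrow> card S \<le> card S'"
    using ex_has_least_nat[of P _ card] by blast
  have "\<not> S \<subseteq> H" using S assms(5) connected_in_mono P_def by metis
  then obtain f where "f \<in> S" "f \<notin> H" by blast
  moreover from this obtain a b where f: "f = {a, b}"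
    using S edges unfolding P_def complete_edges_def by blast
  ultimately have ab: "{a, b} \<in> S" "{a, b} \<notin> H" by auto
  then have ab_T: "{a, b} \<in> T" using S P_def by blast
  let ?R = "S - {{a, b}}" and ?U = "T - {{a, b}}"
  have "finite S" using S assms(1) finite_subset P_def by blast
  then have "\<not> P ?R" using min ab(1) by (metis card_Diff1_less leD)
  then have nR: "\<not> connected_in ?R u v" using S P_def by blast
  have RU: "connected_in ?U x y" if "connected_in ?R x y" for x y
    using that by (rule connected_in_mono) (use S P_def in blast)
  \<comment> \<open>By minimality this walk crosses \<open>{a, b}\<close>. If \<open>?U\<close>
    still connected \<open>u\<close> and \<open>v\<close>, the two pieces of the walk would connect
    \<open>a\<close> and \<open>b\<close> in \<open>?U\<close>, against the bridge property.\<close>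
  have "connected_in (insert {a, b} ?R) u v"
    using S ab(1) P_def by (simp add: insert_absorb)
  then have "\<not> connected_in ?U u v"
  proof (cases rule: connected_in_insertE)
    case 2
    then show ?thesis using RU bridge[OF ab_T] by (meson connected_in_sym connected_in_trans)
  next
    case 3
    then show ?thesis using RU bridge[OF ab_T] by (meson connected_in_sym connected_in_trans)
  qed (use nR in blast)
  with ab ab_T show thesis using that by blast
qed

section \<open>Strong edges\<close>

lemma disconnected_imp_strong:
  assumes "finite V" and e: "e \<in> complete_edges V"
    and disc: "\<not> endpoints_connected (reduced_edges V W e) e"
  shows "e \<in> strong_edges V W"
proof -
  obtain u v where uv: "e = {u, v}" "u \<in> V" "v \<in> V" using e by (auto simp: complete_edges_def)
  have "e \<in> T" if "w \<in> W" and max: "max_spanning_tree V w T" for w T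
  proof (rule ccontr)
    assume "e \<notin> T"
    note T = max_spanning_treeD(1)[OF max]
    have sub: "T \<subseteq> complete_edges V" using T by (simp add: spanning_tree_def)
    have fin: "finite T" using sub \<open>finite V\<close> finite_complete_edges finite_subset by blast
    have "connected_in T u v" using T uv by (simp add: spanning_tree_def)
    moreover have "\<not> connected_in (reduced_edges V W e) u v"
      using disc uv by (auto simp: endpoints_connected_def)
    ultimately obtain a b where ab: "{a, b} \<in> T" "{a, b} \<notin> reduced_edges V W e"
      "\<not> connected_in (T - {{a, b}}) u v"
      using bridge_outside_exists[OF fin _ sub] T unfolding spanning_tree_iff by metis
    \<comment> \<open>This edge differs from \<open>e\<close>, so it can be missing from the reduced
      graph only because \<open>e\<close> dominates it.\<close>
    then have "dominates V W e {a, b}"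
      using sub \<open>e \<notin> T\<close> by (auto simp: reduced_edges_def)
    then have "w {a, b} < w e" using \<open>w \<in> W\<close> by (simp add: dominates_def)
    moreover have "spanning_tree V (insert e (T - {{a, b}}))"
      using spanning_tree_exchange[OF T ab(1)] ab(3) e uv by simp
    then have "sum w (insert e (T - {{a, b}})) \<le> sum w T" by (rule max_spanning_treeD(2)[OF max])
    ultimately show False using sum_exchange[OF fin ab(1) \<open>e \<notin> T\<close>, of w] by simp
  qed
  with e show ?thesis by (auto simp: strong_edges_def all_max_spanning_trees_def)
qed

text \<open>The order first splits the edges into those of the reduced graph of \<open>e\<close>, then \<open>e\<close>, then
  those dominated by \<open>e\<close>; ties are broken by an arbitrary weight function and then by an
  arbitrary numbering.\<close>

lemma low_extension_exists:
  assumes "finite V" "W \<noteq> {}" and e: "e \<in> complete_edges V"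
  shows "\<exists>r \<in> dominance_extensions V W. \<forall>f \<in> reduced_edges V W e. (f, e) \<in> r"
proof -
  let ?E = "complete_edges V"
  obtain w0 where w0: "w0 \<in> W" using assms by blast
  obtain num :: "'a set \<Rightarrow> nat" where num: "inj_on num ?E"
    using finite_complete_edges[OF \<open>finite V\<close>] finite_imp_inj_to_nat_seg by metis
  define lev :: "'a set \<Rightarrow> nat"
    where "lev f = (if f = e then 1 else if dominates V W e f then 0 else 2)" for f
  define less where "less f g \<longleftrightarrow> lev f > lev g \<or> lev f = lev g \<and>
    (w0 f > w0 g \<or> w0 f = w0 g \<and> num f > num g)" for f g
  define r where "r = {(f, g). f \<in> ?E \<and> g \<in> ?E \<and> less f g}"
  have "trans r" by (rule transI) (auto simp: r_def less_def)
  moreover have "irrefl r" by (auto simp: irrefl_def r_def less_def)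
  moreover have "total_on ?E r"
    using num unfolding total_on_def r_def less_def
    by (metis (mono_tags, lifting) case_prod_conv inj_onD linorder_neqE mem_Collect_eq)
  ultimately have "r \<in> strict_total_orders V"
    by (auto simp: strict_total_orders_def strict_linear_order_on_def r_def)
  moreover have "(f, g) \<in> r" if "dominates V W f g" for f g
  proof -
    have "w0 g < w0 f" using that w0 by (simp add: dominates_def)
    \<comment> \<open>Domination by \<open>e\<close> passes from \<open>f\<close> to
      \<open>g\<close> by transitivity, so level 0 is closed downwards. A drop from \<open>f\<close>
      at level 0 to \<open>g = e\<close> is excluded because dominance is asymmetric for non-empty
      \<open>W\<close>.\<close>
    moreover have "lev g \<le> lev f"
    proof -
      have "dominates V W e f \<Longrightarrow> dominates V W e g" 
        using that by (fastforce simp: dominates_def)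
      moreover have "\<not> (dominates V W e f \<and> g = e)"
        using that w0 by (fastforce simp: dominates_def)
      ultimately show ?thesis using that by (auto simp: lev_def)
    qed
    ultimately show ?thesis using that by (auto simp: r_def less_def dominates_def)
  qed
  moreover have "(f, e) \<in> r" if "f \<in> reduced_edges V W e" for f
    using that e by (auto simp: reduced_edges_def r_def less_def lev_def)
  ultimately show ?thesis unfolding dominance_extensions_def by blast
qed

lemma strong_imp_disconnected:
  assumes "finite V" "W \<noteq> {}" and ext: "dominance_extensions V W \<subseteq> consistent_orders V W"
    and strong: "e \<in> strong_edges V W"
  shows "\<not> endpoints_connected (reduced_edges V W e) e"
proof
  assume "endpoints_connected (reduced_edges V W e) e"
  then obtain u v where uv: "e = {u, v}" and conn: "connected_in (reduced_edges V W e) u v"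
    by (auto simp: endpoints_connected_def)
  have e: "e \<in> complete_edges V" using strong by (simp add: strong_edges_def)
  obtain r where r: "r \<in> dominance_extensions V W" "\<forall>f \<in> reduced_edges V W e. (f, e) \<in> r"
    using low_extension_exists[OF assms(1,2) e] by blast
  then have "r \<in> consistent_orders V W" using ext by blast
  then obtain w where "w \<in> W" and "\<forall>(f, g) \<in> r. w f \<ge> w g" by (auto simp: consistent_orders_def)
  with r(2) have w: "w e \<le> w f" if "f \<in> reduced_edges V W e" for f using that by blast
  have in_tree: "e \<in> T" if "max_spanning_tree V w T" for T
    using strong that \<open>w \<in> W\<close> by (auto simp: strong_edges_def all_max_spanning_trees_def)
  obtain T where max: "max_spanning_tree V w T"
    using max_spanning_tree_exists[OF \<open>finite V\<close>] by blast
  note T = max_spanning_treeD(1)[OF max]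
  have "finite T"
    using T \<open>finite V\<close> finite_complete_edges finite_subset spanning_tree_def by metis
  let ?S = "T - {{u, v}}"
  have "\<not> connected_in ?S u v" using T in_tree[OF max] uv by (simp add: spanning_tree_iff)
  \<comment> \<open>Some edge on the walk in the reduced graph must cross the cut that deleting
    \<open>e\<close> opens in the tree.\<close>
  then obtain x y where xy: "{x, y} \<in> reduced_edges V W e" "\<not> connected_in ?S x y"
    using connected_in_hull[OF conn] by blast
  let ?f = "{x, y}"
  have f: "?f \<noteq> e" "?f \<in> complete_edges V" "?f \<notin> T"
    using xy uv connected_in_edge[of x y ?S] by (auto simp: reduced_edges_def)
  have N: "spanning_tree V (insert ?f ?S)"
    using spanning_tree_exchange[OF T _ f(2)] in_tree[OF max] uv xy(2) by simp
  have "sum w (insert ?f ?S) = sum w T + w ?f - w e"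
    using sum_exchange[OF \<open>finite T\<close> in_tree[OF max] f(3)] uv by simp
  \<comment> \<open>The exchange loses no weight, so the new tree is again maximum; it misses
    \<open>e\<close>, although \<open>e\<close> is strong.\<close>
  then have "sum w T \<le> sum w (insert ?f ?S)" using w[OF xy(1)] by simp
  then have "max_spanning_tree V w (insert ?f ?S)"
    using N max by (force simp: max_spanning_tree_def is_arg_max_def)
  from in_tree[OF this] f(1) uv show False by auto
qed

text \<open>The decision on an edge does not depend on the accumulated set, so the fold acts as a
  filter.\<close>

lemma procedure_eq:
  "procedure V W es = {e \<in> set es. \<not> endpoints_connected (reduced_edges V W e) e}"
proof -
  have "fold (\<lambda>e F. if P e then F else insert e F) es F = F \<union> {e \<in> set es. \<not> P e}" for P F
    by (induction es arbitrary: F) auto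
  then show ?thesis by (simp add: procedure_def)
qed

theorem procedure_eq_strong_edges:
  assumes "finite V" "W \<noteq> {}" "dominance_extensions V W = consistent_orders V W"
    and "set es = complete_edges V"
  shows "procedure V W es = strong_edges V W"
proof -
  have "strong_edges V W \<subseteq> complete_edges V" by (auto simp: strong_edges_def)
  then show ?thesis
    using assms disconnected_imp_strong[OF assms(1)] strong_imp_disconnected[OF assms(1,2)]
    unfolding procedure_eq by blast
qed


section \<open>Timed correctness of programs\<close>

text \<open>The value on loops is a dummy.\<close>

fun run :: "(nat \<Rightarrow> nat \<Rightarrow> nat \<Rightarrow> nat \<Rightarrow> bool) \<Rightarrow> com \<Rightarrow> state \<Rightarrow> state" where
  "run orc (Const x n) (\<sigma>, \<alpha>) = (\<sigma>(x := n), \<alpha>)"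
| "run orc (Copy x y) (\<sigma>, \<alpha>) = (\<sigma>(x := \<sigma> y), \<alpha>)"
| "run orc (Succ x y) (\<sigma>, \<alpha>) = (\<sigma>(x := Suc (\<sigma> y)), \<alpha>)"
| "run orc (Load x a y) (\<sigma>, \<alpha>) = (\<sigma>(x := \<alpha> a (\<sigma> y)), \<alpha>)"
| "run orc (Store a x y) (\<sigma>, \<alpha>) = (\<sigma>, \<alpha>(a := (\<alpha> a)(\<sigma> x := \<sigma> y)))"
| "run orc (Query x y1 y2 z1 z2) (\<sigma>, \<alpha>) =
     (\<sigma>(x := (if orc (\<sigma> y1) (\<sigma> y2) (\<sigma> z1) (\<sigma> z2) then 1 else 0)), \<alpha>)"
| "run orc (Seq c1 c2) s = run orc c2 (run orc c1 s)"
| "run orc (IfLess x y c1 c2) (\<sigma>, \<alpha>) =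
     (if \<sigma> x < \<sigma> y then run orc c1 (\<sigma>, \<alpha>) else run orc c2 (\<sigma>, \<alpha>))"
| "run orc (WhileLess x y c) s = s"

fun loop_free :: "com \<Rightarrow> bool" where
  "loop_free (Seq c1 c2) \<longleftrightarrow> loop_free c1 \<and> loop_free c2"
| "loop_free (IfLess x y c1 c2) \<longleftrightarrow> loop_free c1 \<and> loop_free c2"
| "loop_free (WhileLess x y c) \<longleftrightarrow> False"
| "loop_free c \<longleftrightarrow> True"

text \<open>An upper bound, since a test is charged the dearer of its branches. The value on loops,
  given by the last equation, is a dummy.\<close>

fun cost :: "nat \<Rightarrow> com \<Rightarrow> nat" where
  "cost q (Query x y1 y2 z1 z2) = q"
| "cost q (Seq c1 c2) = cost q c1 + cost q c2"
| "cost q (IfLess x y c1 c2) = 1 + max (cost q c1) (cost q c2)"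
| "cost q c = 1"

text \<open>Reduces reasoning about straight-line code and branches to evaluating \<open>run\<close>
  and \<open>cost\<close> by simplification.\<close>

lemma exec_loop_free:
  "loop_free c \<Longrightarrow> \<exists>t. exec orc q c s t (run orc c s) \<and> t \<le> cost q c"
proof (induction c arbitrary: s)
  case (Seq c1 c2)
  then obtain t1 t2 where "exec orc q c1 s t1 (run orc c1 s)" "t1 \<le> cost q c1"
    "exec orc q c2 (run orc c1 s) t2 (run orc c2 (run orc c1 s))" "t2 \<le> cost q c2"
    by (metis loop_free.simps(1))
  then show ?case
    using exec.intros(7) by (fastforce intro!: exI[of _ "t1 + t2"])
next
  case (IfLess x y c1 c2)
  obtain \<sigma> \<alpha> where s: "s = (\<sigma>, \<alpha>)" by fastforce
  show ?case
  proof (cases "\<sigma> x < \<sigma> y")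
    case True
    obtain t where "exec orc q c1 s t (run orc c1 s)" "t \<le> cost q c1"
      using IfLess by (metis loop_free.simps(2))
    with True s show ?thesis by (auto intro!: exI[of _ "1 + t"] exec.intros(8))
  next
    case False
    obtain t where "exec orc q c2 s t (run orc c2 s)" "t \<le> cost q c2"
      using IfLess by (metis loop_free.simps(2))
    with False s show ?thesis by (auto intro!: exI[of _ "1 + t"] exec.intros(9))
  qed
next
  case (Const x n)
  show ?case by (cases s) (auto intro!: exI[of _ 1] exec.intros(1)[unfolded One_nat_def])
next
  case (Copy x n)
  show ?case by (cases s) (auto intro!: exI[of _ 1] exec.intros(2)[unfolded One_nat_def])
next
  case (Succ x n)
  show ?case by (cases s) (auto intro!: exI[of _ 1] exec.intros(3)[unfolded One_nat_def])
next
  case (Load x a y)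
  show ?case by (cases s) (auto intro!: exI[of _ 1] exec.intros(4)[unfolded One_nat_def])
next
  case (Store a x y)
  show ?case by (cases s) (auto intro!: exI[of _ 1] exec.intros(5)[unfolded One_nat_def])
next
  case (Query x y1 y2 z1 z2)
  obtain \<sigma> \<alpha> where "s = (\<sigma>, \<alpha>)" by fastforce
  then show ?case using exec.intros(6)[of orc q x y1 y2 z1 z2 \<sigma> \<alpha>] by (intro exI[of _ q]) simp
qed simp

text \<open>Total correctness with a time bound, since a run in \<open>exec\<close> exists only if
  the program terminates. The start state comes last, so that preconditions are ordinary
  hypotheses.\<close>

definition ensures ::
  "(nat \<Rightarrow> nat \<Rightarrow> nat \<Rightarrow> nat \<Rightarrow> bool) \<Rightarrow> nat \<Rightarrow> nat \<Rightarrow> com \<Rightarrow> (state \<Rightarrow> bool) \<Rightarrow> state \<Rightarrow> bool" where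
  "ensures orc q b c Q s \<longleftrightarrow> (\<exists>t s'. exec orc q c s t s' \<and> t \<le> b \<and> Q s')"

lemma ensures_mono:
  "ensures orc q b c Q s \<Longrightarrow> b \<le> b' \<Longrightarrow> (\<And>s. Q s \<Longrightarrow> Q' s) \<Longrightarrow> ensures orc q b' c Q' s"
  unfolding ensures_def by (meson le_trans)

lemma ensures_loop_free:
  "loop_free c \<Longrightarrow> cost q c \<le> b \<Longrightarrow> Q (run orc c s) \<Longrightarrow> ensures orc q b c Q s"
  unfolding ensures_def using exec_loop_free le_trans by blast

lemma ensures_Seq:
  assumes "ensures orc q b1 c1 P s" and "\<And>s. P s \<Longrightarrow> ensures orc q b2 c2 Q s"
    and "b1 + b2 \<le> b"
  shows "ensures orc q b (Seq c1 c2) Q s"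
proof -
  obtain t1 s' where 1: "exec orc q c1 s t1 s'" "t1 \<le> b1" "P s'"
    using assms(1) by (auto simp: ensures_def)
  obtain t2 s'' where 2: "exec orc q c2 s' t2 s''" "t2 \<le> b2" "Q s''"
    using assms(2)[OF 1(3)] by (auto simp: ensures_def)
  have "exec orc q (Seq c1 c2) s (t1 + t2) s''" using 1 2 by (auto intro: exec.intros)
  moreover have "t1 + t2 \<le> b" using 1 2 assms(3) by linarith
  ultimately show ?thesis using 2(3) unfolding ensures_def by blast
qed

text \<open>The measure bounds the number of iterations, each costing one test plus the body; the
  leading 1 pays for the final failing test.\<close>

lemma ensures_While_measure:
  fixes \<mu> :: "state \<Rightarrow> nat"
  assumes "I s"
    and step: "\<And>s. I s \<Longrightarrow> fst s x < fst s y \<Longrightarrow> ensures orc q b c (\<lambda>s'. I s' \<and> \<mu> s' < \<mu> s) s"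
  shows "ensures orc q (1 + \<mu> s * (1 + b)) (WhileLess x y c) (\<lambda>s. I s \<and> \<not> fst s x < fst s y) s"
  using assms(1)
proof (induction "\<mu> s" arbitrary: s rule: less_induct)
  case less
  obtain \<sigma> \<alpha> where s: "s = (\<sigma>, \<alpha>)" by fastforce
  show ?case
  proof (cases "\<sigma> x < \<sigma> y")
    case True
    then obtain t1 s' where 1: "exec orc q c s t1 s'" "t1 \<le> b" "I s'" "\<mu> s' < \<mu> s"
      using step[OF less.prems] s by (auto simp: ensures_def)
    obtain t2 s'' where 2: "exec orc q (WhileLess x y c) s' t2 s''"
      "t2 \<le> 1 + \<mu> s' * (1 + b)" "I s''" "\<not> fst s'' x < fst s'' y"
      using less.hyps[OF 1(4,3)] by (auto simp: ensures_def)
    have "exec orc q (WhileLess x y c) s (1 + t1 + t2) s''"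
      using exec.intros(11)[of \<sigma> x y, OF True] 1(1) 2(1) s by blast
    moreover have "Suc (\<mu> s') * (1 + b) \<le> \<mu> s * (1 + b)"
      using 1(4) by (intro mult_right_mono) auto
    then have "1 + t1 + t2 \<le> 1 + \<mu> s * (1 + b)" using 1(2) 2(2) by simp
    ultimately show ?thesis using 2 unfolding ensures_def by blast
  next
    case False
    have "exec orc q (WhileLess x y c) s 1 s" using False s exec.intros(10) by blast
    then show ?thesis using False less.prems s unfolding ensures_def by (metis fst_conv le_add1)
  qed
qed

text \<open>The bound is coarsened to a product so that nested loops simply multiply their factors
  \<open>Suc m\<close>.\<close>

lemma ensures_While:
  fixes \<mu> :: "state \<Rightarrow> nat"
  assumes "I s" and "\<mu> s \<le> m" and "Suc m * Suc b \<le> b'"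
    and "\<And>s. I s \<Longrightarrow> fst s x < fst s y \<Longrightarrow> ensures orc q b c (\<lambda>s'. I s' \<and> \<mu> s' < \<mu> s) s"
    and "\<And>s. I s \<Longrightarrow> \<not> fst s x < fst s y \<Longrightarrow> Q s"
  shows "ensures orc q b' (WhileLess x y c) Q s"
proof (rule ensures_mono[OF ensures_While_measure[of I s x y orc q b c \<mu>]])
  have "1 + \<mu> s * (1 + b) \<le> Suc m * Suc b" using mult_le_mono1[OF assms(2), of "Suc b"] by simp
  with assms(3) show "1 + \<mu> s * (1 + b) \<le> b'" by linarith
qed (use assms in auto)

section \<open>The program\<close>

text \<open>
  Variable 0 holds the number of nodes, 1 the length of the output, 2 and 3 the edge under
  consideration, 4 and 5 the pair explored, 6 and 7 the head and tail of the queue, 8 and 9 are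
  temporary, 10 and 11 hold the constants 1 and 0. Array 2 marks the visited nodes and array 3
  is the queue.
\<close>

definition skip :: com where
  "skip = Copy 11 11"

text \<open>Equality has to be tested as the failure of both strict comparisons. Otherwise variable
  8 keeps its value, so a query followed by two such tests computes a disjunction.\<close>

definition mark_equal :: "nat \<Rightarrow> nat \<Rightarrow> com" where
  "mark_equal a b =
     IfLess 4 a skip (IfLess a 4 skip (IfLess 5 b skip (IfLess b 5 skip (Const 8 1))))"

text \<open>After the first three commands variable 8 is 0 exactly if the pair was not excluded.
  Comparing with variable 10, which holds 1, is a test for 0.\<close>

definition explore_pair :: com where
  "explore_pair =
     Seq (Query 8 2 3 4 5) (Seq (mark_equal 2 3) (Seq (mark_equal 3 2) (Seq (Load 9 2 5)
       (Seq (IfLess 9 10 (IfLess 8 10 (Seq (Store 2 5 10) (Seq (Store 3 7 5) (Succ 7 7))) skip) skip)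
         (Succ 5 5)))))"

definition explore_node :: com where
  "explore_node =
     Seq (Seq (Load 4 3 6) (Seq (Succ 6 6) (Const 5 0))) (WhileLess 5 0 explore_pair)"

definition reset_marks :: com where
  "reset_marks = Seq (Const 5 0) (WhileLess 5 0 (Seq (Store 2 5 11) (Succ 5 5)))"

definition start_search :: com where
  "start_search = Seq (Const 6 0) (Seq (Store 2 2 10) (Seq (Store 3 6 2) (Const 7 1)))"

definition emit_edge :: com where
  "emit_edge = Seq (Load 8 2 3)
     (Seq (IfLess 8 10 (Seq (Store 0 1 2) (Seq (Store 1 1 3) (Succ 1 1))) skip) (Succ 3 3))"

definition process_edge :: com where
  "process_edge = Seq reset_marks (Seq start_search (Seq (WhileLess 6 7 explore_node) emit_edge))"

text \<open>Starting the second endpoint at \<open>i + 1\<close> visits each undirected edge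
  once.\<close>

definition process_node :: com where
  "process_node = Seq (Succ 3 2) (Seq (WhileLess 3 0 process_edge) (Succ 2 2))"

definition strong_edges_com :: com where
  "strong_edges_com = Seq (Const 10 1) (WhileLess 2 0 process_node)"

section \<open>Correctness and running time\<close>

text \<open>The pairs \<open>(x, x)\<close> are included, as they do not affect reachability.\<close>

definition adjacency ::
  "nat \<Rightarrow> (nat \<Rightarrow> nat \<Rightarrow> nat \<Rightarrow> nat \<Rightarrow> bool) \<Rightarrow> nat \<Rightarrow> nat \<Rightarrow> (nat \<times> nat) set" where
  "adjacency m orc i j =
     {(x, y). x < m \<and> y < m \<and> \<not> (x = i \<and> y = j) \<and> \<not> (x = j \<and> y = i) \<and> \<not> orc i j x y}"

text \<open>
  The nodes in \<open>Q\<close> before position \<open>h\<close> are explored, the last of them only with respect to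
  the nodes below \<open>l\<close>.
\<close>

definition search_inv ::
  "nat \<Rightarrow> (nat \<times> nat) set \<Rightarrow> nat \<Rightarrow> nat \<Rightarrow> nat \<Rightarrow> nat \<Rightarrow> (nat \<Rightarrow> nat) \<Rightarrow> (nat \<Rightarrow> nat) \<Rightarrow> bool" where
  "search_inv m A i l h t Q vis \<longleftrightarrow>
     h \<le> t \<and> inj_on Q {..<t} \<and> Q ` {..<t} = {y. y < m \<and> 0 < vis y} \<and>
     i < m \<and> 0 < vis i \<and> (\<forall>y < m. 0 < vis y \<longrightarrow> (i, y) \<in> A\<^sup>*) \<and>
     (\<forall>n < h. \<forall>y < m. (Q n, y) \<in> A \<and> (Suc n < h \<or> y < l) \<longrightarrow> 0 < vis y)"

section \<open>Invariant of the breadth-first search\<close>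

lemma search_inv_start:
  "i < m \<Longrightarrow> \<forall>y < m. vis y = 0 \<Longrightarrow> search_inv m A i l 0 1 (Q(0 := i)) (vis(i := 1))"
  by (auto simp: search_inv_def inj_on_def)

text \<open>The queue never repeats a node. This is what bounds the number of iterations of the
  search loop.\<close>

lemma search_inv_tail_le:
  assumes "search_inv m A i l h t Q vis"
  shows "t \<le> m"
proof -
  have "inj_on Q {..<t}" using assms by (simp add: search_inv_def)
  then have "card (Q ` {..<t}) = t" by (simp add: card_image)
  moreover have "card (Q ` {..<t}) \<le> card {..<m}"
    using assms by (intro card_mono) (auto simp: search_inv_def)
  ultimately show ?thesis by simp
qed

text \<open>With \<open>l = m\<close> the previous node is fully explored; the next one enters with
  no neighbour examined, hence \<open>l = 0\<close>.\<close>

lemma search_inv_dequeue: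
  assumes "search_inv m A i m h t Q vis" "h < t"
  shows "search_inv m A i 0 (Suc h) t Q vis"
  using assms unfolding search_inv_def by (auto simp: less_Suc_eq)

lemma search_inv_queue_less:
  assumes "search_inv m A i l h t Q vis" "n < t"
  shows "Q n < m" and "(i, Q n) \<in> A\<^sup>*"
proof -
  have "Q n \<in> {y. y < m \<and> 0 < vis y}" using assms by (auto simp: search_inv_def)
  then show "Q n < m" "(i, Q n) \<in> A\<^sup>*" using assms by (auto simp: search_inv_def)
qed

lemma search_inv_pass:
  assumes "search_inv m A i l h t Q vis" "(Q (h - 1), l) \<in> A \<Longrightarrow> 0 < vis l"
  shows "search_inv m A i (Suc l) h t Q vis"
proof -
  have "0 < vis y" if "n < h" "y < m" "(Q n, y) \<in> A" "Suc n < h \<or> y < Suc l" for n y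
  proof (cases "Suc n < h \<or> y < l")
    case True
    with that assms(1) show ?thesis unfolding search_inv_def by blast
  next
    case False
    with that have "n = h - 1" "y = l" by auto
    with that assms(2) show ?thesis by simp
  qed
  with assms(1) show ?thesis unfolding search_inv_def by simp
qed

lemma search_inv_enqueue:
  assumes inv: "search_inv m A i l h t Q vis" and "0 < h" "l < m" "vis l = 0"
    and edge: "(Q (h - 1), l) \<in> A"
  shows "search_inv m A i (Suc l) h (Suc t) (Q(t := l)) (vis(l := 1))"
proof -
  have "h \<le> t" using inv by (simp add: search_inv_def)
  have img: "Q ` {..<t} = {y. y < m \<and> 0 < vis y}" and inj: "inj_on Q {..<t}"
    using inv by (simp_all add: search_inv_def)
  then have new: "l \<notin> Q ` {..<t}" using \<open>vis l = 0\<close> by simp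
  have "(i, Q (h - 1)) \<in> A\<^sup>*" using search_inv_queue_less(2)[OF inv] \<open>0 < h\<close> \<open>h \<le> t\<close> by simp
  then have reach: "(i, l) \<in> A\<^sup>*" using edge by simp
  have img': "(Q(t := l)) ` {..<Suc t} = {y. y < m \<and> 0 < (vis(l := 1)) y}"
  proof -
    have "(Q(t := l)) ` {..<Suc t} = insert l (Q ` {..<t})" by (auto simp: lessThan_Suc)
    with img \<open>l < m\<close> show ?thesis by auto
  qed
  have inj': "inj_on (Q(t := l)) {..<Suc t}"
    using inj new by (auto simp: lessThan_Suc inj_on_def)
  \<comment> \<open>The new entry lies beyond all explored positions.\<close>
  have Q: "(Q(t := l)) n = Q n" if "n < h" for n using that \<open>h \<le> t\<close> by simp
  have closed: "0 < (vis(l := 1)) y"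
    if "n < h" "y < m" "(Q n, y) \<in> A" "Suc n < h \<or> y < Suc l" for n y
    using that inv unfolding search_inv_def less_Suc_eq[of _ l] by auto
  show ?thesis
    using inv img' inj' reach Q closed unfolding search_inv_def by auto
qed

text \<open>Once the queue is exhausted, the visited nodes contain \<open>i\<close> and are closed
  under \<open>A\<close>, so they include everything reachable; the converse is part of the
  invariant.\<close>

lemma search_inv_final:
  assumes inv: "search_inv m A i m h t Q vis" and "\<not> h < t" and A: "A \<subseteq> {..<m} \<times> {..<m}"
    and "j < m"
  shows "0 < vis j \<longleftrightarrow> (i, j) \<in> A\<^sup>*"
proof
  have "h = t" using assms by (simp add: search_inv_def)
  assume "(i, j) \<in> A\<^sup>*"
  then show "0 < vis j"
  proof (induction rule: rtrancl_induct)
    case (step y z)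
    then have "y < m" "z < m" using A by auto
    then have "y \<in> Q ` {..<t}" using inv step.IH by (simp add: search_inv_def)
    then obtain n where "n < t" "y = Q n" by auto
    with step \<open>z < m\<close> \<open>h = t\<close> show ?case using inv by (auto simp: search_inv_def)
  qed (use inv in \<open>simp add: search_inv_def\<close>)
qed (use assms in \<open>simp add: search_inv_def\<close>)

section \<open>Timed execution of one search\<close>

definition frame ::
  "nat \<Rightarrow> nat \<Rightarrow> nat \<Rightarrow> nat \<Rightarrow> (nat \<Rightarrow> nat) \<Rightarrow> (nat \<Rightarrow> nat) \<Rightarrow> state \<Rightarrow> bool" where
  "frame m k i j o0 o1 s \<longleftrightarrow> fst s 0 = m \<and> fst s 1 = k \<and> fst s 2 = i \<and> fst s 3 = j \<and>
     fst s 10 = 1 \<and> fst s 11 = 0 \<and> snd s 0 = o0 \<and> snd s 1 = o1"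

definition searching ::
  "nat \<Rightarrow> (nat \<times> nat) set \<Rightarrow> nat \<Rightarrow> nat \<Rightarrow> state \<Rightarrow> bool" where
  "searching m A i l s \<longleftrightarrow> search_inv m A i l (fst s 6) (fst s 7) (snd s 3) (snd s 2)"

lemma run_mark_equal:
  "run orc (mark_equal a b) (\<sigma>, \<alpha>) =
     (\<sigma>(8 := (if \<sigma> 4 = \<sigma> a \<and> \<sigma> 5 = \<sigma> b then 1 else \<sigma> 8)), \<alpha>)"
  by (auto simp: mark_equal_def skip_def)

lemma run_explore_pair:
  assumes "\<sigma> 10 = 1" "\<sigma> 0 = m" "\<sigma> 4 < m" "\<sigma> 5 < m"
  obtains z w where "run orc explore_pair (\<sigma>, \<alpha>) =
    (if \<alpha> 2 (\<sigma> 5) = 0 \<and> (\<sigma> 4, \<sigma> 5) \<in> adjacency m orc (\<sigma> 2) (\<sigma> 3)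
     then (\<sigma>(8 := z, 9 := w, 7 := Suc (\<sigma> 7), 5 := Suc (\<sigma> 5)),
           \<alpha>(2 := (\<alpha> 2)(\<sigma> 5 := 1), 3 := (\<alpha> 3)(\<sigma> 7 := \<sigma> 5)))
     else (\<sigma>(8 := z, 9 := w, 5 := Suc (\<sigma> 5)), \<alpha>))"
proof -
  let ?edge = "(\<sigma> 4, \<sigma> 5) \<in> adjacency m orc (\<sigma> 2) (\<sigma> 3)"
  let ?test = "Seq (Query 8 2 3 4 5) (Seq (mark_equal 2 3) (mark_equal 3 2))"
  define z :: nat where "z = (if ?edge then 0 else 1)"
  have edge: "?edge \<longleftrightarrow> \<not> orc (\<sigma> 2) (\<sigma> 3) (\<sigma> 4) (\<sigma> 5) \<and>
      \<not> (\<sigma> 4 = \<sigma> 2 \<and> \<sigma> 5 = \<sigma> 3) \<and> \<not> (\<sigma> 4 = \<sigma> 3 \<and> \<sigma> 5 = \<sigma> 2)"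
    using assms(3,4) by (auto simp: adjacency_def)
  \<comment> \<open>The branches follow the assignments to variable 8 from the last one back to the
    first.\<close>
  have "z = (if \<sigma> 4 = \<sigma> 3 \<and> \<sigma> 5 = \<sigma> 2 then 1 else if \<sigma> 4 = \<sigma> 2 \<and> \<sigma> 5 = \<sigma> 3 then 1
      else if orc (\<sigma> 2) (\<sigma> 3) (\<sigma> 4) (\<sigma> 5) then 1 else 0)"
    unfolding z_def edge by argo
  then have test: "run orc ?test (\<sigma>, \<alpha>) = (\<sigma>(8 := z), \<alpha>)"
    by (simp add: run_mark_equal split del: if_split cong: if_cong)
  have "run orc explore_pair (\<sigma>, \<alpha>) = run orc (Seq (Load 9 2 5)
       (Seq (IfLess 9 10 (IfLess 8 10 (Seq (Store 2 5 10) (Seq (Store 3 7 5) (Succ 7 7))) skip) skip)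
         (Succ 5 5))) (run orc ?test (\<sigma>, \<alpha>))"
    by (simp only: explore_pair_def run.simps)
  also have "\<dots> = (if \<alpha> 2 (\<sigma> 5) = 0 \<and> z = 0
     then (\<sigma>(8 := z, 9 := \<alpha> 2 (\<sigma> 5), 7 := Suc (\<sigma> 7), 5 := Suc (\<sigma> 5)),
           \<alpha>(2 := (\<alpha> 2)(\<sigma> 5 := 1), 3 := (\<alpha> 3)(\<sigma> 7 := \<sigma> 5)))
     else (\<sigma>(8 := z, 9 := \<alpha> 2 (\<sigma> 5), 5 := Suc (\<sigma> 5)), \<alpha>))"
    unfolding test using assms(1) by (cases "\<alpha> 2 (\<sigma> 5)"; cases z) (simp_all add: skip_def fun_upd_idem)
  also have "z = 0 \<longleftrightarrow> ?edge" by (simp add: z_def)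
  finally show thesis by (rule that)
qed

lemma ensures_explore_pair:
  assumes fr: "frame m k i j o0 o1 s" and inv: "searching m (adjacency m orc i j) i (fst s 5) s"
    and head: "0 < fst s 6" "fst s 4 = snd s 3 (fst s 6 - 1)" and "fst s 5 < m"
  shows "ensures orc q (q + 20) explore_pair
    (\<lambda>s'. frame m k i j o0 o1 s' \<and> searching m (adjacency m orc i j) i (fst s' 5) s' \<and>
       fst s' 6 = fst s 6 \<and> fst s' 4 = snd s' 3 (fst s' 6 - 1) \<and> fst s' 5 = Suc (fst s 5)) s"
proof (rule ensures_loop_free)
  obtain \<sigma> \<alpha> where s: "s = (\<sigma>, \<alpha>)" by fastforce
  let ?A = "adjacency m orc i j"
  note \<sigma> = fr[unfolded frame_def s fst_conv snd_conv]
  have inv': "search_inv m ?A i (\<sigma> 5) (\<sigma> 6) (\<sigma> 7) (\<alpha> 3) (\<alpha> 2)"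
    using inv s by (simp add: searching_def)
  then have "\<sigma> 6 \<le> \<sigma> 7" by (simp add: search_inv_def)
  \<comment> \<open>The head was advanced before the scan, so the node being explored sits one
    position before it.\<close>
  then have ht: "\<sigma> 6 - 1 < \<sigma> 7" using head s by simp
  have "\<sigma> 4 < m" using search_inv_queue_less(1)[OF inv' ht] head s by simp
  then obtain z w where run: "run orc explore_pair (\<sigma>, \<alpha>) =
    (if \<alpha> 2 (\<sigma> 5) = 0 \<and> (\<sigma> 4, \<sigma> 5) \<in> ?A
     then (\<sigma>(8 := z, 9 := w, 7 := Suc (\<sigma> 7), 5 := Suc (\<sigma> 5)),
           \<alpha>(2 := (\<alpha> 2)(\<sigma> 5 := 1), 3 := (\<alpha> 3)(\<sigma> 7 := \<sigma> 5)))
     else (\<sigma>(8 := z, 9 := w, 5 := Suc (\<sigma> 5)), \<alpha>))"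
    using run_explore_pair[of \<sigma> m orc \<alpha>] \<sigma> assms(5) s by auto
  show "frame m k i j o0 o1 (run orc explore_pair s) \<and>
    searching m ?A i (fst (run orc explore_pair s) 5) (run orc explore_pair s) \<and>
    fst (run orc explore_pair s) 6 = fst s 6 \<and>
    fst (run orc explore_pair s) 4 =
      snd (run orc explore_pair s) 3 (fst (run orc explore_pair s) 6 - 1) \<and>
    fst (run orc explore_pair s) 5 = Suc (fst s 5)"
  proof (cases "\<alpha> 2 (\<sigma> 5) = 0 \<and> (\<sigma> 4, \<sigma> 5) \<in> ?A")
    case True
    then have "search_inv m ?A i (Suc (\<sigma> 5)) (\<sigma> 6) (Suc (\<sigma> 7))
        ((\<alpha> 3)(\<sigma> 7 := \<sigma> 5)) ((\<alpha> 2)(\<sigma> 5 := 1))"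
      using head s assms(5) by (intro search_inv_enqueue[OF inv']) auto
    then show ?thesis using True head \<sigma> s run ht by (simp add: frame_def searching_def)
  next
    case False
    then have "search_inv m ?A i (Suc (\<sigma> 5)) (\<sigma> 6) (\<sigma> 7) (\<alpha> 3) (\<alpha> 2)"
      using head s by (intro search_inv_pass[OF inv']) auto
    moreover have "run orc explore_pair (\<sigma>, \<alpha>) = (\<sigma>(8 := z, 9 := w, 5 := Suc (\<sigma> 5)), \<alpha>)"
      using False run by presburger
    ultimately show ?thesis using head \<sigma> s by (simp add: frame_def searching_def)
  qed
qed (simp_all add: explore_pair_def mark_equal_def skip_def)

lemma ensures_explore_node:
  assumes fr: "frame m k i j o0 o1 s" and inv: "searching m (adjacency m orc i j) i m s"
    and "fst s 6 < fst s 7"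
  shows "ensures orc q (Suc m * (q + 30)) explore_node
    (\<lambda>s'. frame m k i j o0 o1 s' \<and> searching m (adjacency m orc i j) i m s' \<and>
       fst s' 6 = Suc (fst s 6)) s"
proof -
  let ?A = "adjacency m orc i j"
  define h where "h = fst s 6"
  define I where "I s' \<longleftrightarrow> frame m k i j o0 o1 s' \<and> searching m ?A i (fst s' 5) s' \<and>
    fst s' 6 = Suc h \<and> fst s' 4 = snd s' 3 h \<and> fst s' 5 \<le> m" for s'
  obtain \<sigma> \<alpha> where s: "s = (\<sigma>, \<alpha>)" by fastforce
  have "search_inv m ?A i 0 (Suc (\<sigma> 6)) (\<sigma> 7) (\<alpha> 3) (\<alpha> 2)"
    using inv assms(3) s by (intro search_inv_dequeue) (simp_all add: searching_def)
  then have start: "I (run orc (Seq (Load 4 3 6) (Seq (Succ 6 6) (Const 5 0))) s)"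
    using fr s by (simp add: I_def frame_def searching_def h_def)
  show ?thesis
    unfolding explore_node_def
  proof (rule ensures_Seq[where P = I])
    show "ensures orc q 3 (Seq (Load 4 3 6) (Seq (Succ 6 6) (Const 5 0))) I s"
      using start by (intro ensures_loop_free) simp_all
    show "3 + Suc m * (q + 21) \<le> Suc m * (q + 30)" by (simp add: algebra_simps)
  next
    fix s1 assume "I s1"
    show "ensures orc q (Suc m * (q + 21)) (WhileLess 5 0 explore_pair)
      (\<lambda>s'. frame m k i j o0 o1 s' \<and> searching m ?A i m s' \<and> fst s' 6 = Suc (fst s 6)) s1"
    proof (rule ensures_While[where I = I and \<mu> = "\<lambda>s. m - fst s 5" and m = m and b = "q + 20"])
      fix s2 assume s2: "I s2" "fst s2 5 < fst s2 0"
      then have "fst s2 5 < m" by (simp add: I_def frame_def)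
      show "ensures orc q (q + 20) explore_pair (\<lambda>s'. I s' \<and> m - fst s' 5 < m - fst s2 5) s2"
        using s2 \<open>fst s2 5 < m\<close>
        by (intro ensures_mono[OF ensures_explore_pair[of m k i j o0 o1 s2]]) (auto simp: I_def)
    qed (use \<open>I s1\<close> in \<open>auto simp: I_def frame_def h_def\<close>)
  qed
qed


lemma ensures_reset_marks:
  assumes "frame m k i j o0 o1 s"
  shows "ensures orc q (4 * Suc m) reset_marks
    (\<lambda>s'. frame m k i j o0 o1 s' \<and> (\<forall>y < m. snd s' 2 y = 0)) s"
proof -
  define I where "I s' \<longleftrightarrow> frame m k i j o0 o1 s' \<and> (\<forall>y < fst s' 5. snd s' 2 y = 0)" for s'
  obtain \<sigma> \<alpha> where s: "s = (\<sigma>, \<alpha>)" by fastforce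
  show ?thesis
    unfolding reset_marks_def
  proof (rule ensures_Seq[where P = I])
    show "ensures orc q 1 (Const 5 0) I s"
      using assms s by (intro ensures_loop_free) (simp_all add: I_def frame_def)
    show "1 + Suc m * 3 \<le> 4 * Suc m" by simp
  next
    fix s1 assume "I s1"
    show "ensures orc q (Suc m * 3) (WhileLess 5 0 (Seq (Store 2 5 11) (Succ 5 5)))
      (\<lambda>s'. frame m k i j o0 o1 s' \<and> (\<forall>y < m. snd s' 2 y = 0)) s1"
    proof (rule ensures_While[where I = I and \<mu> = "\<lambda>s. m - fst s 5" and m = m and b = 2])
      fix s2 assume s2: "I s2" "fst s2 5 < fst s2 0"
      obtain \<sigma>2 \<alpha>2 where "s2 = (\<sigma>2, \<alpha>2)" by fastforce
      with s2 show "ensures orc q 2 (Seq (Store 2 5 11) (Succ 5 5))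
          (\<lambda>s'. I s' \<and> m - fst s' 5 < m - fst s2 5) s2"
        by (intro ensures_loop_free) (auto simp: I_def frame_def less_Suc_eq)
    qed (use \<open>I s1\<close> in \<open>auto simp: I_def frame_def\<close>)
  qed
qed

text \<open>Each node is dequeued at most once and then scanned against all \<open>m\<close> nodes,
  which gives the quadratic bound.\<close>

lemma ensures_process_edge:
  assumes fr: "frame m k i j o0 o1 s" and "i < m" "j < m"
  shows "ensures orc q (Suc m * Suc m * (q + 50)) process_edge
    (\<lambda>s'. if (i, j) \<in> (adjacency m orc i j)\<^sup>* then frame m k i (Suc j) o0 o1 s'
          else frame m (Suc k) i (Suc j) (o0(k := i)) (o1(k := j)) s') s"
  (is "ensures orc q _ _ ?Q s")
proof -
  let ?A = "adjacency m orc i j"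
  define I where "I s' \<longleftrightarrow> frame m k i j o0 o1 s' \<and> searching m ?A i m s'" for s'
  define J where "J s' \<longleftrightarrow> frame m k i j o0 o1 s' \<and> (0 < snd s' 2 j \<longleftrightarrow> (i, j) \<in> ?A\<^sup>*)" for s'
  let ?B = "Suc m * (q + 30)"
  have start: "ensures orc q 4 start_search I s1"
    if s1: "frame m k i j o0 o1 s1" "\<forall>y < m. snd s1 2 y = 0" for s1
  proof -
    obtain \<sigma> \<alpha> where s: "s1 = (\<sigma>, \<alpha>)" by fastforce
    have "search_inv m ?A i m 0 1 ((\<alpha> 3)(0 := i)) ((\<alpha> 2)(i := 1))"
      using s1 s \<open>i < m\<close> by (intro search_inv_start) simp_all
    then have "I (run orc start_search s1)"
      using s1 s by (simp add: I_def start_search_def frame_def searching_def)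
    then show ?thesis by (intro ensures_loop_free) (simp_all add: start_search_def)
  qed
  have search: "ensures orc q (Suc m * Suc ?B) (WhileLess 6 7 explore_node) J s1" if "I s1" for s1
  proof (rule ensures_While[where I = I and \<mu> = "\<lambda>s. m - fst s 6" and m = m and b = ?B])
    fix s2 assume s2: "I s2" "fst s2 6 < fst s2 7"
    \<comment> \<open>The head is below the tail and thus below \<open>m\<close>, so advancing it
      strictly decreases \<open>m - head\<close>.\<close>
    then have "fst s2 7 \<le> m" using search_inv_tail_le by (auto simp: I_def searching_def)
    with s2 show "ensures orc q ?B explore_node (\<lambda>s'. I s' \<and> m - fst s' 6 < m - fst s2 6) s2"
      by (intro ensures_mono[OF ensures_explore_node[of m k i j o0 o1 s2]]) (auto simp: I_def)
  next
    fix s2 assume s2: "I s2" "\<not> fst s2 6 < fst s2 7"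
    have "?A \<subseteq> {..<m} \<times> {..<m}" by (auto simp: adjacency_def)
    with s2 show "J s2"
      using search_inv_final[OF _ s2(2) _ \<open>j < m\<close>, of ?A i "snd s2 3" "snd s2 2"]
      by (simp add: I_def J_def searching_def)
  qed (use that in auto)
  have emit: "ensures orc q 7 emit_edge ?Q s1" if "J s1" for s1
  proof -
    obtain \<sigma> \<alpha> where s: "s1 = (\<sigma>, \<alpha>)" by fastforce
    have "?Q (run orc emit_edge s1)"
      using that s by (auto simp: J_def emit_edge_def skip_def frame_def)
    then show ?thesis by (intro ensures_loop_free) (simp_all add: emit_edge_def skip_def)
  qed
  have "ensures orc q (Suc m * Suc ?B + 7) (Seq (WhileLess 6 7 explore_node) emit_edge) ?Q s1"
    if "I s1" for s1
    using ensures_Seq[OF search[OF that] emit order_refl] .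
  then have "ensures orc q (4 + (Suc m * Suc ?B + 7))
      (Seq start_search (Seq (WhileLess 6 7 explore_node) emit_edge)) ?Q s1"
    if "frame m k i j o0 o1 s1" "\<forall>y < m. snd s1 2 y = 0" for s1
    using ensures_Seq[OF start[OF that] _ order_refl] by blast
  then have "ensures orc q (4 * Suc m + (4 + (Suc m * Suc ?B + 7))) process_edge ?Q s"
    unfolding process_edge_def using ensures_Seq[OF ensures_reset_marks[OF fr] _ order_refl] by blast
  then show ?thesis by (rule ensures_mono) (simp_all add: algebra_simps)
qed

section \<open>Enumeration of the edges in lexicographic order\<close>

definition emitted ::
  "nat \<Rightarrow> (nat \<Rightarrow> nat \<Rightarrow> nat \<Rightarrow> nat \<Rightarrow> bool) \<Rightarrow> nat \<Rightarrow> nat \<Rightarrow> nat \<Rightarrow>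
     (nat \<Rightarrow> nat) \<Rightarrow> (nat \<Rightarrow> nat) \<Rightarrow> bool" where
  "emitted m orc i j k o0 o1 \<longleftrightarrow> (\<lambda>n. (o0 n, o1 n)) ` {..<k} =
     {(a, b). a < b \<and> b < m \<and> (a < i \<or> a = i \<and> b < j) \<and> (a, b) \<notin> (adjacency m orc a b)\<^sup>*}"

lemma emitted_skip:
  assumes "emitted m orc i j k o0 o1" "(i, j) \<in> (adjacency m orc i j)\<^sup>*"
  shows "emitted m orc i (Suc j) k o0 o1"
  using assms unfolding emitted_def less_Suc_eq by auto

lemma emitted_add:
  assumes "emitted m orc i j k o0 o1" "i < j" "j < m" "(i, j) \<notin> (adjacency m orc i j)\<^sup>*"
  shows "emitted m orc i (Suc j) (Suc k) (o0(k := i)) (o1(k := j))"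
proof -
  have "(\<lambda>n. ((o0(k := i)) n, (o1(k := j)) n)) ` {..<Suc k} =
      insert (i, j) ((\<lambda>n. (o0 n, o1 n)) ` {..<k})"
    by (auto simp: lessThan_Suc)
  with assms show ?thesis unfolding emitted_def less_Suc_eq by auto
qed

text \<open>Row \<open>i\<close> has no pair with second component at most \<open>i\<close>, so
  starting the row at \<open>i + 1\<close> skips nothing.\<close>

lemma emitted_first: "emitted m orc i 0 k o0 o1 \<Longrightarrow> emitted m orc i (Suc i) k o0 o1"
  unfolding emitted_def by (auto simp: less_Suc_eq)

lemma emitted_last: "emitted m orc i j k o0 o1 \<Longrightarrow> m \<le> j \<Longrightarrow> emitted m orc (Suc i) 0 k o0 o1"
  unfolding emitted_def by (auto simp: less_Suc_eq)

text \<open>The column \<open>j\<close> is a parameter separate from variable 3, since that variable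
  holds a stale value between rows, where \<open>j\<close> is 0.\<close>

definition emitting ::
  "nat \<Rightarrow> (nat \<Rightarrow> nat \<Rightarrow> nat \<Rightarrow> nat \<Rightarrow> bool) \<Rightarrow> nat \<Rightarrow> nat \<Rightarrow> state \<Rightarrow> bool" where
  "emitting m orc i j s \<longleftrightarrow> frame m (fst s 1) i (fst s 3) (snd s 0) (snd s 1) s \<and>
     emitted m orc i j (fst s 1) (snd s 0) (snd s 1)"

lemma ensures_process_node:
  assumes s: "emitting m orc i 0 s" and "i < m"
  shows "ensures orc q (Suc m * Suc m * Suc m * (q + 60)) process_node (emitting m orc (Suc i) 0) s"
proof -
  define I where "I s' \<longleftrightarrow> emitting m orc i (fst s' 3) s' \<and> i < fst s' 3" for s'
  let ?B = "Suc m * Suc m * (q + 50)"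
  have first: "ensures orc q 1 (Succ 3 2) I s"
  proof -
    obtain \<sigma> \<alpha> where "s = (\<sigma>, \<alpha>)" by fastforce
    with s have "I (run orc (Succ 3 2) s)"
      by (auto simp: I_def emitting_def frame_def intro: emitted_first)
    then show ?thesis by (intro ensures_loop_free) simp_all
  qed
  have last: "ensures orc q 1 (Succ 2 2) (emitting m orc (Suc i) 0) s1"
    if "I s1" "\<not> fst s1 3 < m" for s1
  proof -
    obtain \<sigma> \<alpha> where "s1 = (\<sigma>, \<alpha>)" by fastforce
    with that have "emitting m orc (Suc i) 0 (run orc (Succ 2 2) s1)"
      by (auto simp: I_def emitting_def frame_def intro: emitted_last)
    then show ?thesis by (intro ensures_loop_free) simp_all
  qed
  have loop: "ensures orc q (Suc m * Suc ?B) (WhileLess 3 0 process_edge)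
      (\<lambda>s. I s \<and> \<not> fst s 3 < m) s1" if "I s1" for s1
  proof (rule ensures_While[where I = I and \<mu> = "\<lambda>s. m - fst s 3" and m = m and b = ?B])
    fix s2 assume s2: "I s2" "fst s2 3 < fst s2 0"
    let ?j = "fst s2 3"
    have fr: "frame m (fst s2 1) i ?j (snd s2 0) (snd s2 1) s2"
      and em: "emitted m orc i ?j (fst s2 1) (snd s2 0) (snd s2 1)" and j: "i < ?j" "?j < m"
      using s2 by (auto simp: I_def emitting_def frame_def)
    show "ensures orc q ?B process_edge (\<lambda>s'. I s' \<and> m - fst s' 3 < m - fst s2 3) s2"
    proof (rule ensures_mono[OF ensures_process_edge[OF fr \<open>i < m\<close> j(2)] order_refl])
      fix s3
      assume s3: "if (i, ?j) \<in> (adjacency m orc i ?j)\<^sup>*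
        then frame m (fst s2 1) i (Suc ?j) (snd s2 0) (snd s2 1) s3
        else frame m (Suc (fst s2 1)) i (Suc ?j)
               ((snd s2 0)(fst s2 1 := i)) ((snd s2 1)(fst s2 1 := ?j)) s3"
      show "I s3 \<and> m - fst s3 3 < m - fst s2 3"
      proof (cases "(i, ?j) \<in> (adjacency m orc i ?j)\<^sup>*")
        case True
        with s3 j emitted_skip[OF em True] show ?thesis
          by (auto simp: I_def emitting_def frame_def)
      next
        case False
        with s3 j emitted_add[OF em j False] show ?thesis
          by (auto simp: I_def emitting_def frame_def)
      qed
    qed
  qed (use that in \<open>auto simp: I_def emitting_def frame_def\<close>)
  have "ensures orc q (Suc m * Suc ?B + 1) (Seq (WhileLess 3 0 process_edge) (Succ 2 2))
      (emitting m orc (Suc i) 0) s1" if "I s1" for s1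
    using ensures_Seq[OF loop[OF that] _ order_refl] last by blast
  then have "ensures orc q (1 + (Suc m * Suc ?B + 1)) process_node (emitting m orc (Suc i) 0) s"
    unfolding process_node_def using ensures_Seq[OF first _ order_refl] by blast
  then show ?thesis by (rule ensures_mono) (simp_all add: algebra_simps)
qed

lemma ensures_strong_edges_com:
  "ensures orc q (Suc m ^ 4 * (q + 70)) strong_edges_com
     (\<lambda>s. (\<lambda>n. (snd s 0 n, snd s 1 n)) ` {..<fst s 1} =
        {(a, b). a < b \<and> b < m \<and> (a, b) \<notin> (adjacency m orc a b)\<^sup>*}) (initial_state m)"
  (is "ensures orc q _ _ ?Q _")
proof -
  define I where "I s \<longleftrightarrow> emitting m orc (fst s 2) 0 s" for s
  let ?B = "Suc m * Suc m * Suc m * (q + 60)"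
  have "I (run orc (Const 10 1) (initial_state m))"
    by (simp add: initial_state_def I_def emitting_def frame_def emitted_def)
  then have init: "ensures orc q 1 (Const 10 1) I (initial_state m)"
    by (intro ensures_loop_free) simp_all
  have "ensures orc q (Suc m * Suc ?B) (WhileLess 2 0 process_node) ?Q s" if "I s" for s
  proof (rule ensures_While[where I = I and \<mu> = "\<lambda>s. m - fst s 2" and m = m and b = ?B])
    fix s1 assume s1: "I s1" "fst s1 2 < fst s1 0"
    then have "emitting m orc (fst s1 2) 0 s1" and less: "fst s1 2 < m"
      by (auto simp: I_def emitting_def frame_def)
    then show "ensures orc q ?B process_node (\<lambda>s'. I s' \<and> m - fst s' 2 < m - fst s1 2) s1"
      by (rule ensures_mono[OF ensures_process_node])
        (use less in \<open>auto simp: I_def emitting_def frame_def\<close>)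
  next
    fix s1 assume s1: "I s1" "\<not> fst s1 2 < fst s1 0"
    then have "m \<le> fst s1 2" by (simp add: I_def emitting_def frame_def)
    \<comment> \<open>Once the row index has reached \<open>m\<close>, every pair with
      \<open>a < b < m\<close> lies in a finished row.\<close>
    then have "{(a, b). a < b \<and> b < m \<and> (a < fst s1 2 \<or> a = fst s1 2 \<and> b < 0) \<and>
          (a, b) \<notin> (adjacency m orc a b)\<^sup>*} =
        {(a, b). a < b \<and> b < m \<and> (a, b) \<notin> (adjacency m orc a b)\<^sup>*}"
      by auto
    with s1(1) show "?Q s1" unfolding I_def emitting_def emitted_def by simp
  qed (use that in auto)
  then have "ensures orc q (1 + Suc m * Suc ?B) strong_edges_com ?Q (initial_state m)"
    unfolding strong_edges_com_def using ensures_Seq[OF init _ order_refl] by blast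
  then show ?thesis
    by (rule ensures_mono) (simp_all add: algebra_simps power_numeral_reduce)
qed

section \<open>Translation from node numbers back to edges\<close>

lemma reduced_edge_iff_adjacent:
  assumes "distinct vs" "i < length vs" "j < length vs" "x < length vs" "y < length vs" "x \<noteq> y"
  shows "{vs ! x, vs ! y} \<in> reduced_edges (set vs) W {vs ! i, vs ! j} \<longleftrightarrow>
    (x, y) \<in> adjacency (length vs) (dominance_oracle vs W) i j"
  using assms
  by (auto simp: reduced_edges_def adjacency_def dominance_oracle_def complete_edges_iff
      doubleton_eq_iff nth_eq_iff_index_eq)

text \<open>Walks are translated step by step in both directions; a loop \<open>(x, x)\<close> in
  \<open>A\<close> becomes staying at the same node.\<close>

lemma endpoints_connected_iff_reachable:
  fixes vs :: "'a list" and W :: "('a set \<Rightarrow> real) set" and i j :: nat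
  assumes vs: "distinct vs" and ij: "i < length vs" "j < length vs"
  defines "e \<equiv> {vs ! i, vs ! j}" and "A \<equiv> adjacency (length vs) (dominance_oracle vs W) i j"
  shows "endpoints_connected (reduced_edges (set vs) W e) e \<longleftrightarrow> (i, j) \<in> A\<^sup>*"
proof -
  let ?R = "reduced_edges (set vs) W e"
  have "\<exists>y < length vs. v = vs ! y \<and> (i, y) \<in> A\<^sup>*" if "connected_in ?R (vs ! i) v" for v
    using that unfolding connected_in_def
  proof (induction rule: rtrancl_induct)
    case base
    show ?case using ij by blast
  next
    case (step u v)
    then obtain x where x: "x < length vs" "u = vs ! x" "(i, x) \<in> A\<^sup>*" by blast
    have uv: "{u, v} \<in> ?R" using step.hyps by simp
    then have "u \<in> set vs \<and> v \<in> set vs \<and> u \<noteq> v"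
      by (simp add: reduced_edges_def complete_edges_iff)
    then obtain y where y: "y < length vs" "v = vs ! y" "x \<noteq> y"
      using x by (auto simp: in_set_conv_nth)
    then have "(x, y) \<in> A"
      using reduced_edge_iff_adjacent[OF vs ij x(1) y(1,3)] uv x unfolding e_def A_def by simp
    with x y show ?case by (auto intro: rtrancl_into_rtrancl)
  qed
  then have "connected_in ?R (vs ! i) (vs ! j) \<Longrightarrow> (i, j) \<in> A\<^sup>*"
    using vs ij by (metis nth_eq_iff_index_eq)
  moreover have "connected_in ?R (vs ! i) (vs ! y)" if "(i, y) \<in> A\<^sup>*" for y
    using that
  proof (induction rule: rtrancl_induct)
    case (step x y)
    have xy: "x < length vs" "y < length vs" using step.hyps by (auto simp: A_def adjacency_def)
    show ?case
    proof (cases "x = y")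
      case False
      then have "{vs ! x, vs ! y} \<in> ?R"
        using reduced_edge_iff_adjacent[OF vs ij xy] step.hyps unfolding e_def A_def by simp
      with step.IH show ?thesis by (blast intro: connected_in_trans connected_in_edge)
    qed (use step.IH in simp)
  qed simp
  ultimately have "connected_in ?R (vs ! i) (vs ! j) \<longleftrightarrow> (i, j) \<in> A\<^sup>*" by blast
  \<comment> \<open>The existential in \<open>endpoints_connected\<close> may name the endpoints in
    either order, which symmetry makes harmless.\<close>
  moreover have "endpoints_connected ?R e \<longleftrightarrow> connected_in ?R (vs ! i) (vs ! j)"
    unfolding endpoints_connected_def e_def doubleton_eq_iff using connected_in_sym by metis
  ultimately show ?thesis by simp
qed

lemma complete_edges_set_conv_nth:
  "complete_edges (set vs) = {{vs ! a, vs ! b} | a b. a < b \<and> b < length vs}" if "distinct vs"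
proof (intro equalityI subsetI)
  fix e assume "e \<in> complete_edges (set vs)"
  then obtain a b where ab: "e = {vs ! a, vs ! b}" "a < length vs" "b < length vs" "a \<noteq> b"
    by (auto simp: complete_edges_def in_set_conv_nth)
  show "e \<in> {{vs ! a, vs ! b} | a b. a < b \<and> b < length vs}"
  proof (cases "a < b")
    case True
    with ab show ?thesis by blast
  next
    case False
    with ab have "b < a" "e = {vs ! b, vs ! a}" by auto
    with ab(2) show ?thesis by blast
  qed
qed (use that in \<open>auto simp: complete_edges_iff nth_eq_iff_index_eq\<close>)

lemma strong_edges_com_computes:
  assumes vs: "distinct vs" and es: "set es = complete_edges (set vs)"
  shows "computes_within strong_edges_com q vs W (Suc (length vs) ^ 4 * (q + 70))
    (procedure (set vs) W es)"
proof -
  let ?m = "length vs" and ?orc = "dominance_oracle vs W"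
  obtain t s where exec: "exec ?orc q strong_edges_com (initial_state ?m) t s"
    "t \<le> Suc ?m ^ 4 * (q + 70)"
    and out: "(\<lambda>n. (snd s 0 n, snd s 1 n)) ` {..<fst s 1} =
      {(a, b). a < b \<and> b < ?m \<and> (a, b) \<notin> (adjacency ?m ?orc a b)\<^sup>*}" (is "?O = ?S")
    using ensures_strong_edges_com[of ?orc q ?m] unfolding ensures_def by blast
  have "snd s 0 n < ?m \<and> snd s 1 n < ?m" if "n < fst s 1" for n
  proof -
    have "(snd s 0 n, snd s 1 n) \<in> ?S" using that out by blast
    then show ?thesis by auto
  qed
  moreover have "output_edges vs s = procedure (set vs) W es"
  proof -
    let ?e = "\<lambda>(a, b). {vs ! a, vs ! b}"
    have "output_edges vs s = ?e ` ?O" by (auto simp: output_edges_def)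
    also have "\<dots> = {{vs ! a, vs ! b} | a b. a < b \<and> b < ?m \<and> (a, b) \<notin> (adjacency ?m ?orc a b)\<^sup>*}"
      unfolding out by auto
    also have "\<dots> = {e \<in> complete_edges (set vs). \<not> endpoints_connected (reduced_edges (set vs) W e) e}"
      unfolding complete_edges_set_conv_nth[OF vs]
      using endpoints_connected_iff_reachable[OF vs] less_trans by blast
    finally show ?thesis by (simp add: procedure_eq es)
  qed
  ultimately show ?thesis using exec unfolding computes_within_def by blast
qed

text \<open>From \<open>m = 1\<close> on, \<open>Suc m\<close> is at most \<open>2 * m\<close>,
  whence the constant \<open>2 ^ d * c\<close>.\<close>

lemma Suc_power_bigo: "(\<lambda>m. real (Suc m ^ d * c)) \<in> O(\<lambda>m. real m ^ d)"
proof (rule bigoI)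
  show "\<forall>\<^sub>F m in sequentially. norm (real (Suc m ^ d * c)) \<le> (2 ^ d * real c) * norm (real m ^ d)"
    using eventually_ge_at_top[of 1]
  proof eventually_elim
    case (elim m)
    then have "real (Suc m) ^ d \<le> (2 * real m) ^ d" by (intro power_mono) auto
    then have "real (Suc m) ^ d * real c \<le> (2 * real m) ^ d * real c" by (intro mult_right_mono) auto
    then show ?case by (simp add: power_mult_distrib mult_ac)
  qed
qed

theorem mainTheorem2:
  shows "(\<forall>(V :: 'a set) (W :: ('a set \<Rightarrow> real) set) es.
            finite V \<and> W \<noteq> {} \<and> dominance_extensions V W = consistent_orders V W \<and>
            distinct es \<and> set es = complete_edges V \<longrightarrow>
            procedure V W es = strong_edges V W) \<and>
         (\<exists>c. \<forall>q. \<exists>T :: nat \<Rightarrow> nat. (\<lambda>m. real (T m)) \<in> O(\<lambda>m. real m ^ 4) \<and>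
            (\<forall>(V :: 'a set) (W :: ('a set \<Rightarrow> real) set) vs es.
               finite V \<and> W \<noteq> {} \<and> distinct vs \<and> set vs = V \<and>
               distinct es \<and> set es = complete_edges V \<longrightarrow>
               computes_within c q vs W (T (card V)) (procedure V W es)))"
proof (intro conjI exI[of _ strong_edges_com] allI)
  fix q
  show "\<exists>T :: nat \<Rightarrow> nat. (\<lambda>m. real (T m)) \<in> O(\<lambda>m. real m ^ 4) \<and>
      (\<forall>(V :: 'a set) (W :: ('a set \<Rightarrow> real) set) vs es.
         finite V \<and> W \<noteq> {} \<and> distinct vs \<and> set vs = V \<and>
         distinct es \<and> set es = complete_edges V \<longrightarrow>
         computes_within strong_edges_com q vs W (T (card V)) (procedure V W es))"
  \<comment> \<open>The program was fixed before \<open>q\<close>; the cost of an oracle call enters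
    only through a factor that is constant in \<open>m\<close>.\<close>
  proof (intro exI[of _ "\<lambda>m. Suc m ^ 4 * (q + 70)"] conjI Suc_power_bigo allI impI)
    fix V :: "'a set" and W :: "('a set \<Rightarrow> real) set" and vs es
    assume "finite V \<and> W \<noteq> {} \<and> distinct vs \<and> set vs = V \<and>
      distinct es \<and> set es = complete_edges V"
    then show "computes_within strong_edges_com q vs W (Suc (card V) ^ 4 * (q + 70))
        (procedure V W es)"
      using strong_edges_com_computes[of vs es q W] distinct_card[of vs] by auto
  qed
qed (use procedure_eq_strong_edges in blast)

end
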